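(* Let $n\ge 1$ be an integer and $V=\mathbb{C}^n$ with its standard scalar product $\langle\cdot,\cdot\rangle$. For any real number $\varepsilon>0$ there are a norm $f:V\to\mathbb{R}^+$ and a nonzero vector $v\in\mathbb{R}^n$ such that: (1) $f$ admits a unique, up to equivalence, $f$-maximal basis $(e_1,e_2,\dots,e_n)$, with $e_1,\dots,e_n\in\mathbb{R}^n$; and (2) $$(2^n-1-\varepsilon)\,f(v)\ <\ \sum_{i=1}^n |\langle v,e_i\rangle|\, f(e_i).$$
   Context: $\mathbb{R}^+$ denotes the non-negative reals, and $\mathbb{R}^n\subset\mathbb{C}^n$ is the set of vectors with real coordinates. For a finite-dimensional scalar product space $V$ over $\mathbb{F}\in\{\mathbb{R},\mathbb{C}\}$, $\mathbb{S}_1=\{u\in V:\langle u,u\rangle=1\}$. For a norm $f$ on an $n$-dimensional scalar product space $V$, an $f$-maximal basis is an (ordered, orthonormal) basis of $V$ defined inductively on $n$. If $n=1$, then $(b)$ is $f$-maximal for any $b\in\mathbb{S}_1$. If $n>1$, choose $b_1\in\arg\max\{f(b): b\in\mathbb{S}_1\}$, let $V_1=\{u\in V:\langle u,b_1\rangle=0\}$ and let $f_1=f\upharpoonright V_1$; if $(b_2,\dots,b_n)$ is an $f_1$-maximal basis of $V_1$, then $(b_1,b_2,\dots,b_n)$ is an $f$-maximal basis of $V$. Two orthonormal bases $(b_1,\dots,b_n)$ and $(e_1,\dots,e_n)$ of $V$ are equivalent if for every $i\le n$ there is $\alpha_i\in\mathbb{F}$ with $|\alpha_i|=1$ and $e_i=\alpha_i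 b_i$. Thus (1) means that $(e_1,\dots,e_n)$ is an $f$-maximal basis consisting of real vectors and every $f$-maximal basis of $V$ is equivalent to it. *)

theory Defs
  imports "HOL-Analysis.Analysis"
begin

(* The class instance of inner on complex ^ 'n is the real part of the scalar product of C^n,
   so the sesquilinear form itself has to be introduced. *)
definition cscalar :: "complex ^ 'n \<Rightarrow> complex ^ 'n \<Rightarrow> complex" where
  "cscalar u v = (\<Sum>i\<in>UNIV. u $ i * cnj (v $ i))"

definition real_vectors :: "(complex ^ 'n) set" where
  "real_vectors = {u. \<forall>i. u $ i \<in> \<real>}"

definition is_norm :: "(complex ^ 'n \<Rightarrow> real) \<Rightarrow> bool" where
  "is_norm f \<longleftrightarrow>
     (\<forall>u. 0 \<le> f u) \<and>
     (\<forall>u. f u = 0 \<longleftrightarrow> u = 0) \<and>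
     (\<forall>c u. f (c *s u) = cmod c * f u) \<and>
     (\<forall>u v. f (u + v) \<le> f u + f v)"

definition unit_vectors :: "(complex ^ 'n) set \<Rightarrow> (complex ^ 'n) set" where
  "unit_vectors V = {u \<in> V. cscalar u u = 1}"

(* vec.dim is the dimension over the complex numbers. The set argument is meant to be a complex
   subspace V of C^n. The restriction of f to V_1 need not be mentioned: only values of f on V
   enter the definition. *)
inductive maximal_basis ::
  "(complex ^ 'n \<Rightarrow> real) \<Rightarrow> (complex ^ 'n) set \<Rightarrow> (complex ^ 'n) list \<Rightarrow> bool"
  for f :: "complex ^ 'n \<Rightarrow> real" where
  single: "vec.dim V = 1 \<Longrightarrow> b \<in> unit_vectors V \<Longrightarrow> maximal_basis f V [b]"
| step: "vec.dim V > 1 \<Longrightarrow> is_arg_max f (\<lambda>u. u \<in> unit_vectors V) b \<Longrightarrow>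
    maximal_basis f {u \<in> V. cscalar u b = 0} bs \<Longrightarrow> maximal_basis f V (b # bs)"

definition equivalent_bases :: "(complex ^ 'n) list \<Rightarrow> (complex ^ 'n) list \<Rightarrow> bool" where
  "equivalent_bases bs es \<longleftrightarrow>
     list_all2 (\<lambda>b e. \<exists>\<alpha>. cmod \<alpha> = 1 \<and> e = \<alpha> *s b) bs es"

lemma cscalar_add_left: "cscalar (u + v) w = cscalar u w + cscalar v w"
  by (simp add: cscalar_def distrib_right sum.distrib)

lemma cscalar_diff_left: "cscalar (u - v) w = cscalar u w - cscalar v w"
  by (simp add: cscalar_def left_diff_distrib sum_subtractf)

lemma cscalar_scale_left: "cscalar (c *s u) w = c * cscalar u w"
  by (simp add: cscalar_def sum_distrib_left mult.assoc)

lemma subspace_orthogonal: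
  assumes "vec.subspace V"
  shows "vec.subspace {u \<in> V. cscalar u b = 0}"
  using assms unfolding vec.subspace_def
  by (auto simp: cscalar_add_left cscalar_scale_left) (simp add: cscalar_def)

lemma dim_orthogonal:
  assumes V: "vec.subspace V" and b: "b \<in> unit_vectors V"
  shows "vec.dim V = Suc (vec.dim {u \<in> V. cscalar u b = 0})"
proof -
  define W where "W = {u \<in> V. cscalar u b = 0}"
  have W: "vec.subspace W"
    unfolding W_def by (rule subspace_orthogonal[OF V])
  have bV: "b \<in> V" and bb: "cscalar b b = 1"
    using b by (auto simp: unit_vectors_def)
  have "b \<notin> vec.span W"
    using bb W by (simp add: vec.span_eq_iff[THEN iffD2] W_def)
  moreover have "vec.span (insert b W) = V"
  proof
    show "vec.span (insert b W) \<subseteq> V"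
      by (rule vec.span_minimal) (use bV V in \<open>auto simp: W_def\<close>)
    show "V \<subseteq> vec.span (insert b W)"
    proof
      fix u assume u: "u \<in> V"
      have "u - cscalar u b *s b \<in> W"
        using V bV u bb
        by (simp add: W_def cscalar_diff_left cscalar_scale_left vec.subspace_diff
            vec.subspace_scale)
      then show "u \<in> vec.span (insert b W)"
        using vec.span_breakdown_eq vec.span_base by blast
    qed
  qed
  ultimately show ?thesis
    using vec.dim_insert[of b W] vec.dim_span[of "insert b W"] by (simp add: W_def)
qed

lemma maximal_basis_length:
  assumes "maximal_basis f V bs" and "vec.subspace V"
  shows "length bs = vec.dim V"
  using assms
proof (induction rule: maximal_basis.induct)
  case (single V b)
  then show ?case by simp
next
  case (step V b bs)
  then show ?case
    using dim_orthogonal[of V b] subspace_orthogonal[of V b] by (simp add: is_arg_max_def)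
qed

lemma maximal_basis_UNIV_length:
  fixes f :: "complex ^ 'n \<Rightarrow> real"
  assumes "maximal_basis f UNIV bs"
  shows "length bs = CARD('n)"
  using maximal_basis_length[OF assms] by (simp add: vec.dim_UNIV card_cart_basis)

end

theory Submission
  imports Defs
begin

text \<open>
  Take \<open>f u = max\<^sub>k \<bar>\<langle>u, w\<^sub>k\<rangle>\<bar>\<close> with \<open>w\<^sub>k = (s, s \<delta>, \<dots>, s \<delta>\<^sup>k\<^sup>-\<^sup>1, - \<delta>\<^sup>k, 0, \<dots>, 0)\<close>, where \<open>0 \<le> k < n\<close>
  and \<open>s + \<delta> < 1\<close>. On the unit vectors orthogonal to the first \<open>k\<close> vectors of the standard basis,
  \<open>w\<^sub>k\<close> contributes at most \<open>\<delta>\<^sup>k\<close>, with equality only at multiples of the next standard basis vector,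
  and the later functionals stay strictly below \<open>\<delta>\<^sup>k\<close>. Hence the standard basis is the only maximal
  basis. The vector \<open>v\<close> with coordinates \<open>(1 + s)\<^sup>k / \<delta>\<^sup>k\<close> solves \<open>\<langle>v, w\<^sub>k\<rangle> = - 1\<close> for all \<open>k\<close>,
  so \<open>f v = 1\<close>, while the sum in the statement is \<open>\<Sum>k<n. (1 + s)\<^sup>k\<close>, which tends to \<open>2\<^sup>n - 1\<close> as
  \<open>s\<close> tends to \<open>1\<close>.
\<close>

section \<open>Unit vectors and their coordinates\<close>

lemma cscalar_self: "cscalar u u = of_real (\<Sum>i\<in>UNIV. (cmod (u $ i))\<^sup>2)"
  by (simp add: cscalar_def complex_norm_square flip: of_real_power)

lemma cscalar_axis: "cscalar u (c *s axis i 1) = cnj c * u $ i"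
proof -
  have "cscalar u (c *s axis i 1) = (\<Sum>j\<in>UNIV. if j = i then cnj c * u $ i else 0)"
    unfolding cscalar_def by (rule sum.cong) (auto simp: axis_def)
  then show ?thesis by simp
qed

lemma unit_vectors_iff:
  "u \<in> unit_vectors V \<longleftrightarrow> u \<in> V \<and> (\<Sum>i\<in>UNIV. (cmod (u $ i))\<^sup>2) = 1"
  unfolding unit_vectors_def cscalar_self of_real_eq_1_iff by simp

lemma unit_vector_component_le:
  assumes "u \<in> unit_vectors V"
  shows "cmod (u $ i) \<le> 1"
proof -
  have "(cmod (u $ i))\<^sup>2 \<le> (\<Sum>i\<in>UNIV. (cmod (u $ i))\<^sup>2)"
    by (rule member_le_sum) auto
  then show ?thesis
    using assms by (simp add: unit_vectors_iff abs_square_le_1)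
qed

text \<open>The squared moduli sum to 1, so a coordinate of modulus 1 leaves nothing for the
  others.\<close>

lemma unit_vector_eq_axis:
  assumes "u \<in> unit_vectors V" and "cmod (u $ i) = 1"
  shows "u = u $ i *s axis i 1"
proof -
  have "(\<Sum>j\<in>UNIV. (cmod (u $ j))\<^sup>2) = (cmod (u $ i))\<^sup>2 + (\<Sum>j\<in>UNIV - {i}. (cmod (u $ j))\<^sup>2)"
    by (rule sum.remove) auto
  then have "(\<Sum>j\<in>UNIV - {i}. (cmod (u $ j))\<^sup>2) = 0"
    using assms by (simp add: unit_vectors_iff)
  then have "\<forall>j\<in>UNIV - {i}. (cmod (u $ j))\<^sup>2 = 0"
    by (subst (asm) sum_nonneg_eq_0_iff) auto
  then show ?thesis
    by (auto simp: vec_eq_iff axis_def)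
qed

lemma axis_in_unit_vectors:
  assumes "axis i 1 \<in> V"
  shows "axis i 1 \<in> unit_vectors V"
  using assms cscalar_axis[of "axis i 1" 1 i] by (simp add: unit_vectors_def)

section \<open>The norm, the flag of subspaces and the test vector\<close>

locale lacunary_norm =
  fixes s \<delta> :: real and g :: "nat \<Rightarrow> 'n::finite"
  assumes g: "bij_betw g {..<CARD('n)} UNIV"
    and s_pos: "0 < s" and d_pos: "0 < \<delta>" and s_d: "s + \<delta> < 1"
begin

text \<open>The scalar product with \<open>w\<^sub>k\<close>, whose coordinates are real, so no
  conjugation appears. The index type \<open>'n\<close> carries no order; \<open>g\<close> numbers
  the coordinates instead.\<close>

definition functional :: "nat \<Rightarrow> complex ^ 'n \<Rightarrow> complex" where
  "functional k u = of_real s * (\<Sum>j<k. of_real (\<delta> ^ j) * u $ g j) - of_real (\<delta> ^ k) * u $ g k"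

definition f :: "complex ^ 'n \<Rightarrow> real" where
  "f u = Max ((\<lambda>k. cmod (functional k u)) ` {..<CARD('n)})"

text \<open>The subspace left over after \<open>k\<close> steps of the inductive definition of a
  maximal basis.\<close>

definition flag :: "nat \<Rightarrow> (complex ^ 'n) set" where
  "flag k = {u. \<forall>j<k. u $ g j = 0}"

definition v :: "complex ^ 'n" where
  "v = (\<chi> i. of_real (((1 + s) / \<delta>) ^ inv_into {..<CARD('n)} g i))"

abbreviation e :: "nat \<Rightarrow> complex ^ 'n" where
  "e k \<equiv> axis (g k) 1"

section \<open>Norm axioms\<close>

lemma g_eq_iff: "j < CARD('n) \<Longrightarrow> k < CARD('n) \<Longrightarrow> g j = g k \<longleftrightarrow> j = k"
  using g by (auto simp: bij_betw_def inj_on_def)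

lemma g_surj: "\<exists>k<CARD('n). g k = i"
  using g unfolding bij_betw_def by (metis UNIV_I imageE lessThan_iff)

lemma f_ge: "k < CARD('n) \<Longrightarrow> cmod (functional k u) \<le> f u"
  unfolding f_def by (rule Max_ge) auto

lemma f_le: "(\<And>k. k < CARD('n) \<Longrightarrow> cmod (functional k u) \<le> B) \<Longrightarrow> f u \<le> B"
  unfolding f_def by (rule Max.boundedI) (auto simp: lessThan_empty_iff)

lemma f_attained: "\<exists>k<CARD('n). f u = cmod (functional k u)"
proof -
  have "f u \<in> (\<lambda>k. cmod (functional k u)) ` {..<CARD('n)}"
    unfolding f_def by (rule Max_in) (auto simp: lessThan_empty_iff)
  then show ?thesis by auto
qed

lemma functional_add: "functional k (u + w) = functional k u + functional k w"
  by (simp add: functional_def algebra_simps sum.distrib)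

lemma functional_scale: "functional k (c *s u) = c * functional k u"
  by (simp add: functional_def algebra_simps sum_distrib_left)

lemma functional_flag: "u \<in> flag k \<Longrightarrow> functional k u = - of_real (\<delta> ^ k) * u $ g k"
  by (simp add: functional_def flag_def)

text \<open>The functionals form a triangular system with diagonal entries
  \<open>- \<delta> ^ k\<close>, which are nonzero; forward substitution gives
  \<open>u = 0\<close>.\<close>

lemma f_eq_0_imp:
  assumes "f u = 0"
  shows "u = 0"
proof -
  have fun0: "functional k u = 0" if "k < CARD('n)" for k
    using f_ge[OF that, of u] assms by simp
  have "u $ g k = 0" if "k < CARD('n)" for k
    using that
  proof (induction k rule: less_induct)
    case (less k)
    then have "u \<in> flag k"
      by (auto simp: flag_def)
    then show ?case
      using functional_flag[of u k] fun0[OF less.prems] d_pos by simp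
  qed
  then show ?thesis
    using g_surj by (metis vec_eq_iff zero_index)
qed

lemma is_norm_f: "is_norm f"
  unfolding is_norm_def
proof (intro conjI allI)
  fix u w :: "complex ^ 'n" and c :: complex
  show "0 \<le> f u"
    using f_attained[of u] by auto
  show "f u = 0 \<longleftrightarrow> u = 0"
    using f_eq_0_imp f_attained[of 0] by (auto simp: functional_def)
  show "f (u + w) \<le> f u + f w"
  proof (rule f_le)
    fix k assume k: "k < CARD('n)"
    have "cmod (functional k (u + w)) \<le> cmod (functional k u) + cmod (functional k w)"
      by (simp add: functional_add norm_triangle_ineq)
    also have "\<dots> \<le> f u + f w"
      by (intro add_mono f_ge k)
    finally show "cmod (functional k (u + w)) \<le> f u + f w" .
  qed
  show "f (c *s u) = cmod c * f u"
  proof (rule antisym)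
    show "f (c *s u) \<le> cmod c * f u"
      by (rule f_le) (simp add: functional_scale norm_mult mult_left_mono f_ge)
    obtain k where k: "k < CARD('n)" "f u = cmod (functional k u)"
      using f_attained by blast
    then show "cmod c * f u \<le> f (c *s u)"
      using f_ge[of k "c *s u"] by (simp add: functional_scale norm_mult)
  qed
qed

section \<open>Bounds for the functionals on unit vectors of the flag\<close>

lemma geometric_bound:
  assumes "k \<le> i"
  shows "s * (\<Sum>j=k..<i. \<delta> ^ j) + \<delta> ^ i \<le> \<delta> ^ k"
  using assms
proof (induction k rule: inc_induct)
  case base
  show ?case by simp
next
  case (step k)
  \<comment> \<open>Splitting off the term \<open>j = k\<close> leaves a rest bounded by
    \<open>\<delta> ^ Suc k\<close>; together they are absorbed because s + \<delta> < 1.\<close>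
  have "s * (\<Sum>j=k..<i. \<delta> ^ j) + \<delta> ^ i \<le> s * \<delta> ^ k + \<delta> ^ Suc k"
    using step by (simp add: sum.atLeast_Suc_lessThan distrib_left)
  also have "\<dots> = (s + \<delta>) * \<delta> ^ k"
    by (simp add: algebra_simps)
  also have "\<dots> \<le> \<delta> ^ k"
    using s_d d_pos by simp
  finally show ?case .
qed

text \<open>For \<open>k < i\<close> the sum has a term to split off, and there the factor s +
  \<delta> < 1 makes the inequality strict.\<close>

lemma geometric_bound_strict:
  assumes "k < i"
  shows "s * (\<Sum>j=k..<i. \<delta> ^ j) + \<delta> ^ i < \<delta> ^ k"
proof -
  have "s * (\<Sum>j=k..<i. \<delta> ^ j) + \<delta> ^ i \<le> s * \<delta> ^ k + \<delta> ^ Suc k"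
    using geometric_bound[of "Suc k" i] assms
    by (simp add: sum.atLeast_Suc_lessThan distrib_left)
  also have "\<dots> = (s + \<delta>) * \<delta> ^ k"
    by (simp add: algebra_simps)
  also have "\<dots> < \<delta> ^ k"
    using s_d d_pos by simp
  finally show ?thesis .
qed

text \<open>On \<open>flag k\<close> the sum starts only at \<open>j = k\<close>, and each remaining
  coordinate has modulus at most 1, so the triangle inequality reduces the claim to the geometric
  bound.\<close>

lemma functional_less:
  assumes u: "u \<in> unit_vectors (flag k)" and "k < i"
  shows "cmod (functional i u) < \<delta> ^ k"
proof -
  have term_le: "cmod (of_real (\<delta> ^ j) * u $ g j) \<le> \<delta> ^ j" for j
    using unit_vector_component_le[OF u, of "g j"] d_pos
    by (simp add: norm_mult norm_power mult_left_le)
  have "(\<Sum>j<i. of_real (\<delta> ^ j) * u $ g j) = (\<Sum>j=k..<i. of_real (\<delta> ^ j) * u $ g j)"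
    using u by (intro sum.mono_neutral_right) (auto simp: unit_vectors_def flag_def)
  then have "cmod (\<Sum>j<i. of_real (\<delta> ^ j) * u $ g j) \<le> (\<Sum>j=k..<i. \<delta> ^ j)"
    using term_le by (simp only: sum_norm_le)
  then have "cmod (of_real s * (\<Sum>j<i. of_real (\<delta> ^ j) * u $ g j)) \<le> s * (\<Sum>j=k..<i. \<delta> ^ j)"
    unfolding norm_mult using s_pos by simp
  then have "cmod (functional i u) \<le> s * (\<Sum>j=k..<i. \<delta> ^ j) + \<delta> ^ i"
    unfolding functional_def using term_le[of i] by (intro norm_triangle_le_diff add_mono)
  then show ?thesis
    using geometric_bound_strict[OF \<open>k < i\<close>] by linarith
qed

text \<open>Functionals before \<open>k\<close> vanish on \<open>flag k\<close>, the one at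
  \<open>k\<close> reduces to a single coordinate, and the later ones are strictly smaller. This
  bounds \<open>f\<close> by its value at \<open>e k\<close>.\<close>

lemma functional_le:
  assumes u: "u \<in> unit_vectors (flag k)"
  shows "cmod (functional i u) \<le> \<delta> ^ k"
proof (cases i k rule: linorder_cases)
  case less
  then have "functional i u = 0"
    using u by (simp add: functional_def unit_vectors_def flag_def)
  then show ?thesis
    using d_pos by simp
next
  case equal
  then show ?thesis
    using u functional_flag[of u k] unit_vector_component_le[OF u, of "g k"] d_pos
    by (simp add: unit_vectors_def norm_mult norm_power mult_left_le)
next
  case greater
  then show ?thesis
    using functional_less[OF u] by (simp add: less_imp_le)
qed

section \<open>Existence and uniqueness of the maximal basis\<close>

lemma e_in_flag: "k < CARD('n) \<Longrightarrow> e k \<in> flag k"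
  using g_eq_iff by (auto simp: flag_def axis_def)

lemma e_unit: "k < CARD('n) \<Longrightarrow> e k \<in> unit_vectors (flag k)"
  by (simp add: axis_in_unit_vectors e_in_flag)

lemma f_e:
  assumes k: "k < CARD('n)"
  shows "f (e k) = \<delta> ^ k"
proof (rule antisym)
  show "f (e k) \<le> \<delta> ^ k"
    by (rule f_le) (rule functional_le[OF e_unit[OF k]])
  have "cmod (functional k (e k)) = \<delta> ^ k"
    using functional_flag[OF e_in_flag[OF k]] d_pos by (simp add: norm_power)
  then show "\<delta> ^ k \<le> f (e k)"
    using f_ge[OF k, of "e k"] by simp
qed

lemma arg_max_e:
  assumes "k < CARD('n)"
  shows "is_arg_max f (\<lambda>u. u \<in> unit_vectors (flag k)) (e k)"
  unfolding is_arg_max_linorder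
  using assms e_unit f_e functional_le by (auto intro!: f_le)

text \<open>A maximiser reaches \<open>\<delta> ^ k\<close>, which neither the earlier nor the later
  functionals can do. So functional \<open>k\<close> attains \<open>f b\<close>, and this forces the
  modulus of its single surviving coordinate.\<close>

lemma arg_max_imp_cmod:
  assumes k: "k < CARD('n)" and b: "is_arg_max f (\<lambda>u. u \<in> unit_vectors (flag k)) b"
  shows "cmod (b $ g k) = 1"
proof -
  have u: "b \<in> unit_vectors (flag k)" and "f (e k) \<le> f b"
    using b e_unit[OF k] by (auto simp: is_arg_max_linorder)
  then have ge: "\<delta> ^ k \<le> f b"
    using f_e[OF k] by simp
  obtain i where i: "f b = cmod (functional i b)"
    using f_attained by blast
  have "i = k"
  proof (cases i k rule: linorder_cases)
    case less
    then have "functional i b = 0"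
      using u by (simp add: functional_def unit_vectors_def flag_def)
    then show ?thesis
      using ge i zero_less_power[OF d_pos, of k] by simp
  next
    case greater
    then show ?thesis
      using functional_less[OF u] ge i by fastforce
  qed simp
  then have "\<delta> ^ k \<le> \<delta> ^ k * cmod (b $ g k)"
    using ge i functional_flag[of b k] u d_pos
    by (simp add: unit_vectors_def norm_mult norm_power)
  then have "1 \<le> cmod (b $ g k)"
    using d_pos by simp
  then show ?thesis
    using unit_vector_component_le[OF u, of "g k"] by simp
qed

text \<open>The factor \<open>c\<close> is needed because a maximiser is determined only up to a
  scalar of modulus 1.\<close>

lemma flag_Suc:
  assumes "c \<noteq> 0"
  shows "{u \<in> flag k. cscalar u (c *s e k) = 0} = flag (Suc k)"
  using assms by (auto simp: cscalar_axis flag_def less_Suc_eq)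

lemma subspace_flag: "vec.subspace (flag k)"
  by (auto simp: flag_def vec.subspace_def)

lemma dim_flag: "k \<le> CARD('n) \<Longrightarrow> vec.dim (flag k) = CARD('n) - k"
proof (induction k)
  case 0
  have "flag 0 = UNIV"
    by (simp add: flag_def)
  then show ?case
    by (simp add: vec.dim_UNIV card_cart_basis)
next
  case (Suc k)
  have "vec.dim (flag k) = Suc (vec.dim (flag (Suc k)))"
    using dim_orthogonal[OF subspace_flag e_unit, of k] Suc.prems flag_Suc[of 1 k] by simp
  then show ?case
    using Suc by simp
qed

lemma maximal_basis_e:
  assumes "k < CARD('n)"
  shows "maximal_basis f (flag k) (map e [k..<CARD('n)])"
proof -
  \<comment> \<open>The induction runs downwards from the last index, where the flag is
    one-dimensional and \<open>single\<close> applies.\<close>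
  have "k \<le> CARD('n) - 1"
    using assms by simp
  then show ?thesis
  proof (induction k rule: inc_induct)
    case base
    have "[CARD('n) - 1..<CARD('n)] = [CARD('n) - 1]"
      by (simp add: upt_rec)
    moreover have "maximal_basis f (flag (CARD('n) - 1)) [e (CARD('n) - 1)]"
    proof (rule maximal_basis.single)
      have "1 \<le> CARD('n)"
        by (simp add: Suc_leI)
      then show "vec.dim (flag (CARD('n) - 1)) = 1"
        using dim_flag[of "CARD('n) - 1"] by simp
    qed (simp add: e_unit)
    ultimately show ?case by simp
  next
    case (step k)
    then have "maximal_basis f (flag k) (e k # map e [Suc k..<CARD('n)])"
      by (intro maximal_basis.step)
        (use flag_Suc[of 1 k] in \<open>auto simp: dim_flag arg_max_e\<close>)
    then show ?case
      using step by (simp add: upt_conv_Cons)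
  qed
qed

lemma unit_multiple_e:
  assumes "b \<in> unit_vectors V" and "cmod (b $ g k) = 1"
  shows "\<exists>\<alpha>. cmod \<alpha> = 1 \<and> e k = \<alpha> *s b"
proof (intro exI conjI)
  show "cmod (inverse (b $ g k)) = 1"
    using assms by (simp add: norm_inverse)
  have "b $ g k \<noteq> 0"
    using assms(2) by auto
  then show "e k = inverse (b $ g k) *s b"
    by (subst unit_vector_eq_axis[OF assms]) (simp add: vector_smult_assoc)
qed

text \<open>Each chosen vector is a unimodular multiple of \<open>e k\<close>, so its orthogonal
  complement in \<open>flag k\<close> is again a member of the flag. The equation
  \<open>V = flag k\<close> keeps \<open>V\<close> a variable for the rule induction.\<close>

lemma maximal_basis_equivalent:
  assumes "maximal_basis f V bs" and "V = flag k" and "k < CARD('n)"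
  shows "equivalent_bases bs (map e [k..<CARD('n)])"
  using assms
proof (induction arbitrary: k rule: maximal_basis.induct)
  case (single V b)
  then have k: "CARD('n) = Suc k"
    using dim_flag[of k] by simp
  \<comment> \<open>The rule \<open>single\<close> demands no maximality. Here \<open>k\<close> is
    the last index, so only coordinate \<open>g k\<close> can be nonzero.\<close>
  have "b $ i = 0" if "i \<noteq> g k" for i
    using that g_surj[of i] k single unfolding flag_def unit_vectors_def
    by (metis (mono_tags, lifting) less_SucE mem_Collect_eq)
  then have "(\<Sum>i\<in>UNIV. (cmod (b $ i))\<^sup>2) = (\<Sum>i\<in>{g k}. (cmod (b $ i))\<^sup>2)"
    by (intro sum.mono_neutral_right) auto
  then have "cmod (b $ g k) = 1"
    using single by (simp add: unit_vectors_iff abs_square_eq_1)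
  then show ?case
    using unit_multiple_e[OF single.hyps(2)] k by (simp add: equivalent_bases_def)
next
  case (step V b bs)
  have k: "Suc k < CARD('n)"
    using step.hyps(1) step.prems dim_flag[of k] by simp
  have b: "b \<in> unit_vectors (flag k)" "cmod (b $ g k) = 1"
    using step.hyps(2) step.prems arg_max_imp_cmod[of k b] by (auto simp: is_arg_max_linorder)
  have "{u \<in> V. cscalar u b = 0} = flag (Suc k)"
    using b(2) step.prems(1) flag_Suc[of "b $ g k" k] unit_vector_eq_axis[OF b] by force
  then have "equivalent_bases bs (map e [Suc k..<CARD('n)])"
    using step.IH k by blast
  then show ?case
    using unit_multiple_e[OF b] k by (simp add: equivalent_bases_def upt_conv_Cons)
qed

section \<open>Values at the test vector\<close>

lemma v_g: "k < CARD('n) \<Longrightarrow> v $ g k = of_real (((1 + s) / \<delta>) ^ k)"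
  using g by (simp add: v_def bij_betw_def)

text \<open>The powers of \<delta> cancel against those in the coordinates of \<open>v\<close>, and
  the geometric sum telescopes: s times it is \<open>(1 + s) ^ k - 1\<close>.\<close>

lemma functional_v:
  assumes k: "k < CARD('n)"
  shows "functional k v = - 1"
proof -
  have vd: "of_real (\<delta> ^ j) * v $ g j = of_real ((1 + s) ^ j)" if "j < CARD('n)" for j
    using that v_g[OF that] d_pos by (simp add: power_divide)
  have "(\<Sum>j<k. of_real (\<delta> ^ j) * v $ g j) = of_real (\<Sum>j<k. (1 + s) ^ j)"
    unfolding of_real_sum using k by (intro sum.cong refl vd) auto
  then have "functional k v = of_real (s * (\<Sum>j<k. (1 + s) ^ j) - (1 + s) ^ k)"
    using vd[OF k] by (simp add: functional_def)
  also have "s * (\<Sum>j<k. (1 + s) ^ j) = (1 + s) ^ k - 1"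
    using power_diff_1_eq[of "1 + s" k] by simp
  finally show ?thesis by simp
qed

lemma f_v: "f v = 1"
  using f_attained[of v] functional_v by auto

text \<open>The factor \<open>\<delta> ^ k\<close> from \<open>f (e k)\<close> cancels the
  denominator of the coordinate of \<open>v\<close>, so the sum depends on s alone.\<close>

lemma sum_v:
  "(\<Sum>k<CARD('n). cmod (cscalar v (map e [0..<CARD('n)] ! k)) * f (map e [0..<CARD('n)] ! k))
    = (\<Sum>k<CARD('n). (1 + s) ^ k)"
proof (rule sum.cong[OF refl])
  fix k assume "k \<in> {..<CARD('n)}"
  then have k: "k < CARD('n)" by simp
  have "cmod (cscalar v (e k)) = ((1 + s) / \<delta>) ^ k"
    using cscalar_axis[of v 1 "g k"] v_g[OF k] s_pos d_pos
    by (simp add: norm_power norm_divide del: of_real_power of_real_divide of_real_add)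
  then show "cmod (cscalar v (map e [0..<CARD('n)] ! k)) * f (map e [0..<CARD('n)] ! k) = (1 + s) ^ k"
    using k f_e[OF k] d_pos by (simp add: power_divide)
qed

end

section \<open>Choice of the parameters and conclusion\<close>

lemma geometric_sum_near_2:
  fixes \<epsilon> :: real
  assumes "\<epsilon> > 0"
  obtains s where "0 < s" "s < 1" "2 ^ n - 1 - \<epsilon> < (\<Sum>k<n. (1 + s) ^ k)"
proof -
  have "((\<lambda>s. \<Sum>k<n. (1 + s) ^ k) \<longlongrightarrow> (\<Sum>k<n. (1 + 1) ^ k)) (at_left (1::real))"
    by (intro tendsto_intros)
  \<comment> \<open>At s = 1 the sum equals \<open>2 ^ n - 1\<close>, so by continuity the strict
    bound persists slightly to the left of 1.\<close>
  moreover have "2 ^ n - 1 - \<epsilon> < (\<Sum>k<n. (1 + 1 :: real) ^ k)"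
    using power_diff_1_eq[of "2 :: real" n] assms by simp
  ultimately have "eventually (\<lambda>s. 2 ^ n - 1 - \<epsilon> < (\<Sum>k<n. (1 + s) ^ k)) (at_left (1::real))"
    by (rule order_tendstoD)
  moreover have "eventually (\<lambda>s. s \<in> {0<..<1}) (at_left (1::real))"
    by (rule eventually_at_left_real) simp
  ultimately have "eventually (\<lambda>s. s \<in> {0<..<1} \<and>
      2 ^ n - 1 - \<epsilon> < (\<Sum>k<n. (1 + s) ^ k)) (at_left (1::real))"
    by (rule eventually_conj[rotated])
  then show thesis
    using that eventually_happens'[OF trivial_limit_at_left_real]
    by (metis (lifting) greaterThanLessThan_iff)
qed

theorem proposition7:
  fixes \<epsilon> :: real
  assumes "\<epsilon> > 0"
  shows "\<exists>(f :: complex ^ 'n \<Rightarrow> real) (v :: complex ^ 'n).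
    is_norm f \<and> v \<in> real_vectors \<and> v \<noteq> 0 \<and>
    (\<exists>es. maximal_basis f UNIV es \<and> set es \<subseteq> real_vectors \<and>
       (\<forall>bs. maximal_basis f UNIV bs \<longrightarrow> equivalent_bases bs es) \<and>
       (2 ^ CARD('n) - 1 - \<epsilon>) * f v < (\<Sum>i<CARD('n). cmod (cscalar v (es ! i)) * f (es ! i)))"
proof -
  obtain s where s: "0 < s" "s < 1" "2 ^ CARD('n) - 1 - \<epsilon> < (\<Sum>k<CARD('n). (1 + s) ^ k)"
    using geometric_sum_near_2[OF assms] .
  obtain g :: "nat \<Rightarrow> 'n" where g: "bij_betw g {..<CARD('n)} UNIV"
    using ex_bij_betw_nat_finite[of "UNIV :: 'n set"] by (auto simp: atLeast0LessThan)
  \<comment> \<open>With this \<delta>, s + \<delta> is the midpoint of s and 1, hence below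
    1.\<close>
  interpret lacunary_norm s "(1 - s) / 2" g
    using s g by unfold_locales (auto simp: field_simps)
  let ?es = "map e [0..<CARD('n)]"
  have flag_0: "UNIV = flag 0"
    by (simp add: flag_def)
  show ?thesis
  proof (intro exI conjI allI impI)
    show "is_norm f"
      by (rule is_norm_f)
    show "v \<in> real_vectors"
      by (simp add: real_vectors_def v_def)
    show "v \<noteq> 0"
      using f_v is_norm_f unfolding is_norm_def by (metis zero_neq_one)
    show "maximal_basis f UNIV ?es"
      unfolding flag_0 by (rule maximal_basis_e) simp
    show "set ?es \<subseteq> real_vectors"
      by (auto simp: real_vectors_def axis_def)
    show "equivalent_bases bs ?es" if "maximal_basis f UNIV bs" for bs
      using maximal_basis_equivalent[OF that flag_0] by simp
    show "(2 ^ CARD('n) - 1 - \<epsilon>) * f v < (\<Sum>i<CARD('n). cmod (cscalar v (?es ! i)) * f (?es ! i))"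
      unfolding sum_v f_v using s(3) by simp
  qed
qed

end
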